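(* Let $G$ be an abelian group. For any space $\mathfrak{X}$, the homology $H_*\bigl(G[\mathrm{CSing}(\mathrm{MinCtl}(\mathfrak{X}))]\bigr)$ is the usual (compactly supported) singular homology of $\mathfrak{X}$ with coefficients in $G$.
   Context: A space is an object of a convenient category $\mathbf{Top}$ of topological spaces (e.g. compactly generated spaces). A controlled set is a set $X$ equipped with a family $\mathcal{U}(X)$ of subsets of $X$ (the controlled subsets) that contains every finite subset of $X$ and is closed under taking subsets and under binary unions. A map $f\colon Y\to X$ of controlled sets is controlled if for every $L\in\mathcal{U}(Y)$ one has $f(L)\in\mathcal{U}(X)$, and $f^{-1}(\{x\})\cap L$ is finite for every $x\in X$. A simplicial controlled set is a simplicial object in the category of controlled sets and controlled maps. For a controlled set $X$, $G[X]$ is the abelian group of formal sums $\sum_{x\in X}[x]g_x$ with $g_x\in G$ such that the support $\{x\in X: g_x\neq 0\}$ lies in $\mathcal{U}(X)$. It is a covariant functor: for a controlled map $f\colon Y\to X$, $f_*(\sum_y [y]g_y)=\sum_y [f(y)]g_y$, adding coefficients where necessary. Applying $G[-]$ to a simplicial controlled set $X$ in each degree gives a simplicial abelian group $G[X]$, and $H_*(G[X])$ denotes the homology of the associated chain complex (with boundary the alternating sum of face maps). For a set $S$, $\mathrm{MinCtl}(S)$ is the set $S$ whose controlled subsets are exactly the finite subsets. For a space $\mathfrak{X}$, $\mathrm{CSing}(\mathrm{MinCtl}(\mathfrak{X}))$ is the simplicial controlled set $\mathrm{MinCtl}\circ\mathrm{Sing}(\mathfrak{X})$, i.e. the singular simplicial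 set $\mathrm{Sing}(\mathfrak{X})$ with controlled set $\mathrm{MinCtl}(\mathrm{Sing}(\mathfrak{X})_n)$ in degree $n$. *)

theory Defs
  imports "HOL-Homology.Homology"
begin

section \<open>Controlled sets\<close>

record 'a controlled_set =
  points :: "'a set"
  controlled :: "'a set set"

definition is_controlled_set :: "'a controlled_set \<Rightarrow> bool" where
  "is_controlled_set X \<longleftrightarrow>
     controlled X \<subseteq> Pow (points X) \<and>
     (\<forall>A. finite A \<and> A \<subseteq> points X \<longrightarrow> A \<in> controlled X) \<and>
     (\<forall>A B. A \<in> controlled X \<and> B \<subseteq> A \<longrightarrow> B \<in> controlled X) \<and>
     (\<forall>A B. A \<in> controlled X \<and> B \<in> controlled X \<longrightarrow> A \<union> B \<in> controlled X)"

definition controlled_map :: "'a controlled_set \<Rightarrow> 'b controlled_set \<Rightarrow> ('a \<Rightarrow> 'b) \<Rightarrow> bool" where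
  "controlled_map Y X f \<longleftrightarrow>
     f \<in> points Y \<rightarrow> points X \<and>
     (\<forall>L \<in> controlled Y. f ` L \<in> controlled X \<and>
        (\<forall>x \<in> points X. finite {y \<in> L. f y = x}))"

definition MinCtl :: "'a set \<Rightarrow> 'a controlled_set" where
  "MinCtl S = \<lparr>points = S, controlled = {A. A \<subseteq> S \<and> finite A}\<rparr>"

section \<open>Simplicial objects\<close>

text \<open>Morphisms \<open>[m] \<rightarrow> [n]\<close> of the simplex category, where \<open>[n] = {..n}\<close>.\<close>

definition delta_maps :: "nat \<Rightarrow> nat \<Rightarrow> (nat \<Rightarrow> nat) set" where
  "delta_maps m n = {\<theta> \<in> {..m} \<rightarrow>\<^sub>E {..n}. mono_on {..m} \<theta>}"

text \<open>For \<open>\<theta> \<in> delta_maps m n\<close>, \<open>act S m n \<theta>\<close> is the structure map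
  \<open>\<theta>\<^sup>* : obj S n \<rightarrow> obj S m\<close>; it is meaningful only on the points of \<open>obj S n\<close>.\<close>

record ('o, 'a) simplicial =
  obj :: "nat \<Rightarrow> 'o"
  act :: "nat \<Rightarrow> nat \<Rightarrow> (nat \<Rightarrow> nat) \<Rightarrow> 'a \<Rightarrow> 'a"

definition simplicial_controlled_set :: "('a controlled_set, 'a) simplicial \<Rightarrow> bool" where
  "simplicial_controlled_set S \<longleftrightarrow>
     (\<forall>n. is_controlled_set (obj S n)) \<and>
     (\<forall>m n. \<forall>\<theta> \<in> delta_maps m n. controlled_map (obj S n) (obj S m) (act S m n \<theta>)) \<and>
     (\<forall>n. \<forall>x \<in> points (obj S n). act S n n (\<lambda>j\<in>{..n}. j) x = x) \<and>
     (\<forall>k m n. \<forall>\<eta> \<in> delta_maps k m. \<forall>\<theta> \<in> delta_maps m n. \<forall>x \<in> points (obj S n).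
        act S k n (compose {..k} \<theta> \<eta>) x = act S k m \<eta> (act S m n \<theta> x))"

text \<open>The injection \<open>[m] \<rightarrow> [m + 1]\<close> that omits \<open>i\<close>, and the face map
  \<open>d\<^sub>i\<close> out of degree \<open>n \<ge> 1\<close>.\<close>

definition coface :: "nat \<Rightarrow> nat \<Rightarrow> nat \<Rightarrow> nat" where
  "coface m i = (\<lambda>j\<in>{..m}. if j < i then j else Suc j)"

definition face :: "('o, 'a) simplicial \<Rightarrow> nat \<Rightarrow> nat \<Rightarrow> 'a \<Rightarrow> 'a" where
  "face S n i = act S (n - 1) n (coface (n - 1) i)"

text \<open>The affine map of standard simplices that sends vertex \<open>i\<close> to vertex \<open>\<theta> i\<close>.\<close>

definition simplex_map :: "nat \<Rightarrow> (nat \<Rightarrow> nat) \<Rightarrow> (nat \<Rightarrow> real) \<Rightarrow> nat \<Rightarrow> real" where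
  "simplex_map m \<theta> x = (\<lambda>j. \<Sum>i | i \<le> m \<and> \<theta> i = j. x i)"

definition Sing :: "'a topology \<Rightarrow> (((nat \<Rightarrow> real) \<Rightarrow> 'a) set, (nat \<Rightarrow> real) \<Rightarrow> 'a) simplicial" where
  "Sing X = \<lparr>obj = (\<lambda>n. singular_simplex_set n X),
             act = (\<lambda>m n \<theta> \<sigma>. restrict (\<sigma> \<circ> simplex_map m \<theta>) (standard_simplex m))\<rparr>"

definition CSing_MinCtl ::
    "'a topology \<Rightarrow> (((nat \<Rightarrow> real) \<Rightarrow> 'a) controlled_set, (nat \<Rightarrow> real) \<Rightarrow> 'a) simplicial" where
  "CSing_MinCtl X = \<lparr>obj = MinCtl \<circ> obj (Sing X), act = act (Sing X)\<rparr>"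

section \<open>Homology of chain complexes\<close>

text \<open>A nonnegatively graded complex has groups \<open>C n\<close> and differentials
  \<open>d n : C n \<rightarrow> C (n - 1)\<close>, with the convention that \<open>d 0\<close> is the zero map on \<open>C 0\<close>.\<close>

definition chain_homology :: "(nat \<Rightarrow> 'c monoid) \<Rightarrow> (nat \<Rightarrow> 'c \<Rightarrow> 'c) \<Rightarrow> nat \<Rightarrow> 'c set monoid" where
  "chain_homology C d n =
     (C n)\<lparr>carrier := kernel (C n) (C (n - 1)) (d n)\<rparr> Mod (d (Suc n) ` carrier (C (Suc n)))"

section \<open>Controlled chains\<close>

text \<open>The group \<open>G[X]\<close>, where \<open>G\<close> is the type \<open>'g\<close>. A formal sum is its coefficient function,
  which vanishes off \<open>points X\<close> because controlled subsets lie in \<open>points X\<close>.\<close>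

definition ctl_sums :: "'a controlled_set \<Rightarrow> ('a \<Rightarrow> 'g::ab_group_add) monoid" where
  "ctl_sums X = \<lparr>carrier = {c. {x. c x \<noteq> 0} \<in> controlled X},
                 monoid.mult = (\<lambda>c c'. \<lambda>x. c x + c' x),
                 one = (\<lambda>x. 0)\<rparr>"

text \<open>The sum ranges over the support only: it is finite when \<open>f\<close> is controlled
  and \<open>c \<in> carrier (ctl_sums Y)\<close>, whereas the full fibre of \<open>f\<close> may be infinite.\<close>

definition pushforward :: "('a \<Rightarrow> 'b) \<Rightarrow> ('a \<Rightarrow> 'g) \<Rightarrow> 'b \<Rightarrow> 'g::ab_group_add" where
  "pushforward f c = (\<lambda>x. \<Sum>y | f y = x \<and> c y \<noteq> 0. c y)"

definition ctl_boundary ::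
    "('a controlled_set, 'a) simplicial \<Rightarrow> nat \<Rightarrow> ('a \<Rightarrow> 'g) \<Rightarrow> 'a \<Rightarrow> 'g::ab_group_add" where
  "ctl_boundary S n c =
     (if n = 0 then (\<lambda>x. 0)
      else (\<lambda>x. \<Sum>i\<le>n. (uminus ^^ i) (pushforward (face S n i) c x)))"

definition ctl_homology ::
    "nat \<Rightarrow> ('a controlled_set, 'a) simplicial \<Rightarrow> ('a \<Rightarrow> 'g::ab_group_add) set monoid" where
  "ctl_homology n S = chain_homology (\<lambda>k. ctl_sums (obj S k)) (ctl_boundary S) n"

section \<open>Singular homology with coefficients\<close>

text \<open>HOL-Homology treats integer coefficients only. As there, chains are finitely supported
  formal sums of singular simplices, now with coefficients in \<open>'g\<close>; the lemma
  \<open>singular_homology_int\<close> below says that \<open>'g = int\<close> gives back \<open>homology_group\<close>.\<close>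

definition singular_chain_group ::
    "nat \<Rightarrow> 'a topology \<Rightarrow> (((nat \<Rightarrow> real) \<Rightarrow> 'a) \<Rightarrow>\<^sub>0 'g::ab_group_add) monoid" where
  "singular_chain_group n X =
     \<lparr>carrier = {c. Poly_Mapping.keys c \<subseteq> singular_simplex_set n X},
      monoid.mult = (+), one = 0\<rparr>"

definition singular_boundary ::
    "nat \<Rightarrow> (((nat \<Rightarrow> real) \<Rightarrow> 'a) \<Rightarrow>\<^sub>0 'g) \<Rightarrow> (((nat \<Rightarrow> real) \<Rightarrow> 'a) \<Rightarrow>\<^sub>0 'g::ab_group_add)" where
  "singular_boundary n c =
     (if n = 0 then 0
      else \<Sum>\<sigma>\<in>Poly_Mapping.keys c. \<Sum>i\<le>n.
             Poly_Mapping.single (singular_face n i \<sigma>) ((uminus ^^ i) (Poly_Mapping.lookup c \<sigma>)))"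

definition singular_homology ::
    "nat \<Rightarrow> 'a topology \<Rightarrow> (((nat \<Rightarrow> real) \<Rightarrow> 'a) \<Rightarrow>\<^sub>0 'g::ab_group_add) set monoid" where
  "singular_homology n X = chain_homology (\<lambda>k. singular_chain_group k X) singular_boundary n"

section \<open>Consistency of the definitions\<close>

lemma simplex_map_in_standard_simplex:
  assumes "\<theta> \<in> delta_maps m n" "x \<in> standard_simplex m"
  shows "simplex_map m \<theta> x \<in> standard_simplex n"
proof -
  have x: "\<And>i. 0 \<le> x i" and s: "(\<Sum>i\<le>m. x i) = 1"
    using assms by (auto simp: standard_simplex_def)
  have \<theta>: "\<theta> ` {..m} \<subseteq> {..n}"
    using assms by (auto simp: delta_maps_def)
  have "(\<Sum>j\<le>n. simplex_map m \<theta> x j) = (\<Sum>j\<le>n. \<Sum>i | i \<in> {..m} \<and> \<theta> i = j. x i)"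
    by (simp add: simplex_map_def)
  also have "\<dots> = (\<Sum>i\<le>m. x i)"
    using \<theta> by (intro sum.group) auto
  finally have tot: "(\<Sum>j\<le>n. simplex_map m \<theta> x j) = 1" using s by simp
  have ge: "0 \<le> simplex_map m \<theta> x j" for j
    using x by (simp add: simplex_map_def sum_nonneg)
  have le: "simplex_map m \<theta> x j \<le> 1" for j
    unfolding simplex_map_def s[symmetric] using x by (intro sum_mono2) auto
  have "simplex_map m \<theta> x j = 0" if "n < j" for j
  proof -
    have "{i. i \<le> m \<and> \<theta> i = j} = {}" using \<theta> that by force
    then show ?thesis unfolding simplex_map_def by (simp only: sum.empty)
  qed
  with tot ge le show ?thesis by (simp add: standard_simplex_def)
qed

lemma singular_simplex_simplex_map:
  assumes "\<theta> \<in> delta_maps m n" "singular_simplex n X \<sigma>"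
  shows "singular_simplex m X (restrict (\<sigma> \<circ> simplex_map m \<theta>) (standard_simplex m))"
proof -
  have "continuous_map (subtopology (powertop_real UNIV) (standard_simplex m))
          (subtopology (powertop_real UNIV) (standard_simplex n)) (simplex_map m \<theta>)"
    unfolding continuous_map_in_subtopology continuous_map_componentwise
  proof (intro conjI allI ballI)
    show "simplex_map m \<theta> \<in> topspace (subtopology (powertop_real UNIV) (standard_simplex m)) \<rightarrow> standard_simplex n"
      using simplex_map_in_standard_simplex[OF assms(1)] by auto
    show "continuous_map (subtopology (powertop_real UNIV) (standard_simplex m)) euclideanreal
            (\<lambda>x. simplex_map m \<theta> x k)" for k
      unfolding simplex_map_def
      by (intro continuous_map_sum continuous_map_from_subtopology
            continuous_map_product_projection) auto
  qed auto
  from continuous_map_compose[OF this, of X \<sigma>] assms(2) show ?thesis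
    by (simp add: singular_simplex_def)
qed

lemma simplex_map_compose:
  assumes "\<eta> \<in> delta_maps k m"
  shows "simplex_map k (compose {..k} \<theta> \<eta>) x = simplex_map m \<theta> (simplex_map k \<eta> x)"
proof
  fix j
  have \<eta>: "\<eta> ` {..k} \<subseteq> {..m}" using assms by (auto simp: delta_maps_def)
  have "simplex_map m \<theta> (simplex_map k \<eta> x) j
      = (\<Sum>l | l \<le> m \<and> \<theta> l = j. \<Sum>i | i \<in> {i. i \<le> k \<and> \<theta> (\<eta> i) = j} \<and> \<eta> i = l. x i)"
    unfolding simplex_map_def by (intro sum.cong refl) auto
  also have "\<dots> = (\<Sum>i | i \<le> k \<and> \<theta> (\<eta> i) = j. x i)"
    using \<eta> by (intro sum.group) auto
  also have "\<dots> = simplex_map k (compose {..k} \<theta> \<eta>) x j"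
    unfolding simplex_map_def by (intro sum.cong) (auto simp: compose_def)
  finally show "simplex_map k (compose {..k} \<theta> \<eta>) x j = simplex_map m \<theta> (simplex_map k \<eta> x) j" ..
qed

lemma simplex_map_id:
  assumes "x \<in> standard_simplex n"
  shows "simplex_map n (\<lambda>j\<in>{..n}. j) x = x"
proof
  fix j
  have "{i. i \<le> n \<and> (\<lambda>j\<in>{..n}. j) i = j} = (if j \<le> n then {j} else {})" by auto
  then show "simplex_map n (\<lambda>j\<in>{..n}. j) x j = x j"
    using assms by (simp add: simplex_map_def standard_simplex_def)
qed

proposition simplicial_controlled_set_CSing_MinCtl: "simplicial_controlled_set (CSing_MinCtl X)"
  unfolding simplicial_controlled_set_def
proof (intro conjI allI ballI)
  show "is_controlled_set (obj (CSing_MinCtl X) n)" for n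
    by (auto simp: is_controlled_set_def CSing_MinCtl_def MinCtl_def intro: finite_subset)
  show "controlled_map (obj (CSing_MinCtl X) n) (obj (CSing_MinCtl X) m) (act (CSing_MinCtl X) m n \<theta>)"
    if "\<theta> \<in> delta_maps m n" for m n \<theta>
    using singular_simplex_simplex_map[OF that]
    by (auto simp: controlled_map_def CSing_MinCtl_def MinCtl_def Sing_def)
  show "act (CSing_MinCtl X) n n (\<lambda>j\<in>{..n}. j) \<sigma> = \<sigma>"
    if "\<sigma> \<in> points (obj (CSing_MinCtl X) n)" for n \<sigma>
  proof -
    have "\<sigma> \<in> extensional (standard_simplex n)"
      using that by (auto simp: CSing_MinCtl_def MinCtl_def Sing_def singular_simplex_def)
    then have "restrict (\<sigma> \<circ> simplex_map n (\<lambda>j\<in>{..n}. j)) (standard_simplex n) = \<sigma>"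
      by (intro extensionalityI[of _ "standard_simplex n"])
         (simp_all only: restrict_extensional restrict_apply' comp_apply simplex_map_id)
    then show ?thesis by (simp only: CSing_MinCtl_def Sing_def simplicial.simps)
  qed
  show "act (CSing_MinCtl X) k n (compose {..k} \<theta> \<eta>) \<sigma> =
        act (CSing_MinCtl X) k m \<eta> (act (CSing_MinCtl X) m n \<theta> \<sigma>)"
    if "\<eta> \<in> delta_maps k m" for k m n \<eta> \<theta> \<sigma>
  proof -
    have "restrict (\<sigma> \<circ> simplex_map k (compose {..k} \<theta> \<eta>)) (standard_simplex k) =
          restrict (restrict (\<sigma> \<circ> simplex_map m \<theta>) (standard_simplex m) \<circ> simplex_map k \<eta>) (standard_simplex k)"
      by (intro restrict_ext)
         (simp only: comp_apply simplex_map_compose[OF that] restrict_apply'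
            simplex_map_in_standard_simplex[OF that])
    then show ?thesis by (simp only: CSing_MinCtl_def Sing_def simplicial.simps)
  qed
qed

lemma frag_cmul_single: "frag_cmul a (Poly_Mapping.single x b) = Poly_Mapping.single x (a * b)"
  by (rule poly_mapping_eqI) (auto simp: lookup_single when_def)

lemma singular_boundary_int: "singular_boundary n (c :: 'a chain) = chain_boundary n c"
proof -
  have *: "(uminus ^^ i) a = (-1) ^ i * (a :: int)" for i a
    by (induction i) auto
  show ?thesis
    by (simp add: singular_boundary_def chain_boundary_def frag_extend_def frag_cmul_sum o_def
          * frag_cmul_single mult.commute)
qed

proposition singular_homology_int:
  "(singular_homology n X :: 'a chain set monoid) = homology_group (int n) X"
proof -
  have C: "singular_chain_group k X = chain_group k X" for k
    by (simp add: singular_chain_group_def chain_group_def free_Abelian_group_def)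
  have cyc: "kernel (chain_group n X) (chain_group (n - 1) X) (chain_boundary n)
      = singular_relcycle_set n X {}"
    by (auto simp: kernel_def singular_cycle)
  have rel: "relcycle_group n X {} = (chain_group n X)\<lparr>carrier := singular_relcycle_set n X {}\<rparr>"
    using carrier_relcycle_group[of n X "{}"]
    by (simp add: relcycle_group_def subgroup_generated_def)
  have bd: "chain_boundary (Suc n) ` singular_chain_set (Suc n) X = singular_relboundary_set n X {}"
    by (auto simp add: singular_boundary image_def)
  show ?thesis
    by (simp add: singular_homology_def chain_homology_def relative_homology_group_def C
          singular_boundary_int[abs_def] cyc rel bd del: One_nat_def)
qed

end

theory Submission
  imports Defs
begin

text \<open>In \<open>MinCtl\<close> the controlled subsets are exactly the finite ones, so
  G[MinCtl(S)] consists of the finitely supported functions on S. For S the set of singular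
  n-simplices these are the usual singular n-chains, and reading off coefficients
  (\<open>Poly_Mapping.lookup\<close>) is an isomorphism in each degree
  (\<open>lookup_iso_ctl_sums\<close>). The simplicial face maps are the usual singular faces
  (\<open>face_CSing_MinCtl\<close>), so exchanging two finite sums identifies the differentials
  (\<open>lookup_singular_boundary\<close>). Isomorphic complexes have isomorphic homology
  (\<open>chain_homology_iso\<close>).\<close>

text \<open>A degreewise isomorphism that commutes with the differentials matches cycles with cycles
  and boundaries with boundaries, hence cosets with cosets. Homology classes are sets of chains, so
  the induced map is direct image. Since 0 - 1 = 0 on naturals, \<open>d 0\<close> is an endomap of
  \<open>C 0\<close>.\<close>

lemma chain_homology_iso:
  assumes C: "\<And>k. group (C k)" and D: "\<And>k. group (D k)"
    and f: "\<And>k. f k \<in> iso (C k) (D k)"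
    and d: "\<And>k. d (Suc k) \<in> carrier (C (Suc k)) \<rightarrow> carrier (C k)"
    and d0: "d 0 \<in> carrier (C 0) \<rightarrow> carrier (C 0)"
    and comm: "\<And>k c. c \<in> carrier (C k) \<Longrightarrow> f (k - 1) (d k c) = e k (f k c)"
  shows "(`) (f n) \<in> iso (chain_homology C d n) (chain_homology D e n)"
proof -
  have inj: "inj_on (f k) (carrier (C k))" and im: "f k ` carrier (C k) = carrier (D k)"
    and mult: "\<And>x y. x \<in> carrier (C k) \<Longrightarrow> y \<in> carrier (C k) \<Longrightarrow>
      f k (x \<otimes>\<^bsub>C k\<^esub> y) = f k x \<otimes>\<^bsub>D k\<^esub> f k y" for k
    using f[of k] by (auto simp: iso_def bij_betw_def hom_def)
  have one: "f k \<one>\<^bsub>C k\<^esub> = \<one>\<^bsub>D k\<^esub>" for k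
    using hom_one[OF _ C D] f by (auto simp: iso_def)
  define Z B where "Z = kernel (C n) (C (n - 1)) (d n)"
    and "B = d (Suc n) ` carrier (C (Suc n))"
  have Z: "Z \<subseteq> carrier (C n)" and B: "B \<subseteq> carrier (C n)"
    using d by (auto simp: Z_def B_def kernel_def)
  have dn: "d n c \<in> carrier (C (n - 1))" if "c \<in> carrier (C n)" for c
    using d d0 that by (cases n) auto
  \<comment> \<open>Injectivity of \<open>f (n - 1)\<close> lets the vanishing of the boundary be
    reflected, not only preserved.\<close>
  have "e n (f n c) = \<one>\<^bsub>D (n - 1)\<^esub> \<longleftrightarrow> d n c = \<one>\<^bsub>C (n - 1)\<^esub>" if "c \<in> carrier (C n)" for c
    using inj_on_eq_iff[OF inj dn[OF that] monoid.one_closed[OF group.is_monoid[OF C]]]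
    by (simp add: comm[OF that, symmetric] one)
  then have fZ: "f n ` Z = kernel (D n) (D (n - 1)) (e n)"
    by (auto simp: Z_def kernel_def im[symmetric])
  have fB: "f n ` B = e (Suc n) ` carrier (D (Suc n))"
    using comm[of _ "Suc n"] by (simp add: B_def im[symmetric] image_image)
  have coset: "f n ` (B #>\<^bsub>C n\<^esub> a) = f n ` B #>\<^bsub>D n\<^esub> f n a" if "a \<in> Z" for a
  proof -
    have "f n (b \<otimes>\<^bsub>C n\<^esub> a) = f n b \<otimes>\<^bsub>D n\<^esub> f n a" if "b \<in> B" for b
      using mult that \<open>a \<in> Z\<close> Z B by blast
    then show ?thesis
      by (auto simp: r_coset_def image_UN)
  qed
  note simps = chain_homology_def FactGroup_def
  \<comment> \<open>Shrinking the carrier to the cycles leaves multiplication unchanged, so cosets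
    and their products can be computed in \<open>C n\<close> itself.\<close>
  have carC: "carrier (chain_homology C d n) = (\<lambda>a. B #>\<^bsub>C n\<^esub> a) ` Z"
    unfolding simps Z_def B_def by (simp add: RCOSETS_def r_coset_def) blast
  have carD: "carrier (chain_homology D e n) = (\<lambda>a. f n ` B #>\<^bsub>D n\<^esub> a) ` f n ` Z"
    unfolding simps fZ fB by (simp add: RCOSETS_def r_coset_def) blast
  have multC: "mult (chain_homology C d n) = set_mult (C n)"
    and multD: "mult (chain_homology D e n) = set_mult (D n)"
    by (auto simp: simps set_mult_def fun_eq_iff)
  have sub: "K \<subseteq> carrier (C n)" if "K \<in> carrier (chain_homology C d n)" for K
    using that Z B monoid.r_coset_subset_G[OF group.is_monoid[OF C] B] by (auto simp: carC)
  have im_car: "(`) (f n) ` carrier (chain_homology C d n) = carrier (chain_homology D e n)"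
    by (simp add: carC carD image_image coset cong: image_cong)
  have "inj_on ((`) (f n)) (carrier (chain_homology C d n))"
    using inj_on_image_eq_iff[OF inj] sub by (meson inj_onI)
  moreover have "f n ` (K <#>\<^bsub>C n\<^esub> L) = f n ` K <#>\<^bsub>D n\<^esub> f n ` L"
    if "K \<subseteq> carrier (C n)" "L \<subseteq> carrier (C n)" for K L
  proof -
    have "f n (x \<otimes>\<^bsub>C n\<^esub> y) = f n x \<otimes>\<^bsub>D n\<^esub> f n y" if "x \<in> K" "y \<in> L" for x y
      using mult that \<open>K \<subseteq> carrier (C n)\<close> \<open>L \<subseteq> carrier (C n)\<close> by blast
    then show ?thesis
      by (auto simp: set_mult_def image_UN)
  qed
  ultimately show ?thesis
    using im_car sub by (auto simp: iso_def hom_def bij_betw_def multC multD)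
qed

lemma group_singular_chain_group: "group (singular_chain_group n X)"
proof (rule groupI)
  fix c :: "((nat \<Rightarrow> real) \<Rightarrow> 'a) \<Rightarrow>\<^sub>0 'g::ab_group_add"
  assume "c \<in> carrier (singular_chain_group n X)"
  then show "\<exists>c' \<in> carrier (singular_chain_group n X). c' \<otimes>\<^bsub>singular_chain_group n X\<^esub> c = \<one>\<^bsub>singular_chain_group n X\<^esub>"
    by (intro bexI[of _ "- c"]) (auto simp: singular_chain_group_def in_keys_iff)
qed (auto simp: singular_chain_group_def add.assoc dest!: subsetD[OF Poly_Mapping.keys_add])

text \<open>The support of a sum lies in the union of the supports, so closure under unions and
  subsets gives closure under addition; the zero sum has empty, hence controlled, support.\<close>

lemma group_ctl_sums:
  assumes "is_controlled_set X"
  shows "group (ctl_sums X :: ('a \<Rightarrow> 'g::ab_group_add) monoid)"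
proof (rule groupI)
  have sub: "A \<in> controlled X" if "B \<in> controlled X" "A \<subseteq> B" for A B
    using assms that by (auto simp: is_controlled_set_def)
  fix c c' :: "'a \<Rightarrow> 'g"
  assume c: "c \<in> carrier (ctl_sums X)"
  then show "\<exists>c' \<in> carrier (ctl_sums X). c' \<otimes>\<^bsub>ctl_sums X\<^esub> c = \<one>\<^bsub>ctl_sums X\<^esub>"
    by (intro bexI[of _ "\<lambda>x. - c x"]) (auto simp: ctl_sums_def)
  assume "c' \<in> carrier (ctl_sums X)"
  with c have "{x. c x \<noteq> 0} \<union> {x. c' x \<noteq> 0} \<in> controlled X"
    using assms by (auto simp: is_controlled_set_def ctl_sums_def)
  then show "c \<otimes>\<^bsub>ctl_sums X\<^esub> c' \<in> carrier (ctl_sums X)"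
    by (auto simp: ctl_sums_def elim!: sub)
qed (use assms in \<open>auto simp: ctl_sums_def add.assoc is_controlled_set_def\<close>)

lemma lookup_iso_ctl_sums:
  "Poly_Mapping.lookup \<in> iso (singular_chain_group n X) (ctl_sums (obj (CSing_MinCtl X) n))"
proof -
  have "c \<in> Poly_Mapping.lookup ` carrier (singular_chain_group n X)"
    if "c \<in> carrier (ctl_sums (obj (CSing_MinCtl X) n))" for c :: "_ \<Rightarrow> 'b"
  \<comment> \<open>Surjectivity: a controlled support is finite here, so
    \<open>Abs_poly_mapping c\<close> really has coefficient function \<open>c\<close>.\<close>
  proof (rule image_eqI[of _ _ "Abs_poly_mapping c"])
    have "finite {x. c x \<noteq> 0}" "{x. c x \<noteq> 0} \<subseteq> singular_simplex_set n X"
      using that by (auto simp: ctl_sums_def CSing_MinCtl_def MinCtl_def Sing_def)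
    then show "c = Poly_Mapping.lookup (Abs_poly_mapping c)"
      "Abs_poly_mapping c \<in> carrier (singular_chain_group n X)"
      by (auto simp: singular_chain_group_def in_keys_iff)
  qed
  then show ?thesis
    by (auto simp: iso_def hom_def bij_betw_def inj_on_def lookup_inject plus_poly_mapping.rep_eq
        singular_chain_group_def ctl_sums_def CSing_MinCtl_def MinCtl_def Sing_def in_keys_iff)
qed

text \<open>Every simplex occurring in the boundary is a face of one occurring in the chain.\<close>

lemma singular_boundary_closed:
  "singular_boundary (Suc n) \<in> carrier (singular_chain_group (Suc n) X) \<rightarrow> carrier (singular_chain_group n X)"
proof (rule Pi_I)
  fix c :: "((nat \<Rightarrow> real) \<Rightarrow> 'a) \<Rightarrow>\<^sub>0 'g::ab_group_add"
  assume c: "c \<in> carrier (singular_chain_group (Suc n) X)"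
  have "singular_simplex n X \<tau>" if "\<tau> \<in> Poly_Mapping.keys (singular_boundary (Suc n) c)" for \<tau>
  proof -
    have "Poly_Mapping.keys (singular_boundary (Suc n) c) \<subseteq>
        (\<Union>\<sigma>\<in>Poly_Mapping.keys c. \<Union>i\<le>Suc n. {singular_face (Suc n) i \<sigma>})"
      unfolding singular_boundary_def if_not_P[OF nat.distinct(2)]
      by (intro order_trans[OF Poly_Mapping.keys_sum] UN_mono order_refl) (auto split: if_splits)
    with that obtain \<sigma> i where "\<sigma> \<in> Poly_Mapping.keys c" "i \<le> Suc n" "\<tau> = singular_face (Suc n) i \<sigma>"
      by blast
    with c show ?thesis
      using singular_simplex_singular_face[of "Suc n" X \<sigma> i] by (auto simp: singular_chain_group_def)
  qed
  then show "singular_boundary (Suc n) c \<in> carrier (singular_chain_group n X)"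
    by (auto simp: singular_chain_group_def)
qed

lemma simplex_map_coface:
  assumes "x \<in> standard_simplex m" "k \<le> Suc m"
  shows "simplex_map m (coface m k) x = simplical_face k x"
proof
  fix j
  \<comment> \<open>Each fibre of the coface has at most one vertex, so the coordinate sum
    collapses. Beyond \<open>Suc m\<close> the fibre is empty, in agreement with
    \<open>simplical_face\<close> because points of the simplex vanish past
    \<open>m\<close>.\<close>
  have "{i. i \<le> m \<and> coface m k i = j} =
      (if j < k then {j} else if j = k then {} else if j \<le> Suc m then {j - 1} else {})"
    using assms(2) by (auto simp: coface_def split: if_splits)
  with assms show "simplex_map m (coface m k) x j = simplical_face k x j"
    by (auto simp: simplex_map_def simplical_face_def standard_simplex_def)
qed

text \<open>Both sides are restricted to the standard simplex of dimension \<open>n - 1\<close>, so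
  agreement of the affine maps there gives equality on every \<open>\<sigma>\<close>, singular
  simplex or not.\<close>

lemma face_CSing_MinCtl:
  assumes "0 < n" "i \<le> n"
  shows "face (CSing_MinCtl X) n i = singular_face n i"
proof
  fix \<sigma>
  show "face (CSing_MinCtl X) n i \<sigma> = singular_face n i \<sigma>"
    using assms by (auto simp: face_def CSing_MinCtl_def Sing_def singular_face_def simplex_map_coface
        intro!: restrict_ext)
qed

lemma lookup_singular_boundary:
  "Poly_Mapping.lookup (singular_boundary n c) = ctl_boundary (CSing_MinCtl X) n (Poly_Mapping.lookup c)"
proof (cases "n = 0")
  case False
  \<comment> \<open>The sign is an iterated negation, as \<open>'g\<close> has no multiplication;
    being additive, it passes through the sum over a fibre.\<close>
  have u: "(uminus ^^ i) (sum g A) = (\<Sum>a\<in>A. (uminus ^^ i) (g a))" for i and g :: "'z \<Rightarrow> 'b" and A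
    by (induction i) (auto simp: sum_negf)
  have "Poly_Mapping.lookup (singular_boundary n c) \<tau>
      = (\<Sum>\<sigma>\<in>Poly_Mapping.keys c. \<Sum>i\<le>n.
          if singular_face n i \<sigma> = \<tau> then (uminus ^^ i) (Poly_Mapping.lookup c \<sigma>) else 0)" for \<tau>
    using False by (simp add: singular_boundary_def lookup_sum lookup_single when_def)
  also have "\<dots> \<tau> = (\<Sum>i\<le>n. \<Sum>\<sigma>\<in>Poly_Mapping.keys c.
          if singular_face n i \<sigma> = \<tau> then (uminus ^^ i) (Poly_Mapping.lookup c \<sigma>) else 0)" for \<tau>
    by (rule sum.swap)
  \<comment> \<open>\<open>pushforward\<close> sums over the part of the support lying over
    \<open>\<tau>\<close>; the support is the set of keys, so this is the inner conditional
    sum.\<close>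
  also have "\<dots> \<tau> = (\<Sum>i\<le>n. (uminus ^^ i) (pushforward (singular_face n i) (Poly_Mapping.lookup c) \<tau>))" for \<tau>
    by (simp add: pushforward_def u sum.inter_filter[symmetric] in_keys_iff[symmetric] conj_commute)
  finally show ?thesis
    using False by (auto simp: ctl_boundary_def face_CSing_MinCtl fun_eq_iff)
qed (auto simp: singular_boundary_def ctl_boundary_def)

theorem proposition5p2:
  fixes X :: "'a topology"
  shows "\<forall>n. (\<lambda>K. Poly_Mapping.lookup ` K) \<in>
           iso (singular_homology n X :: (((nat \<Rightarrow> real) \<Rightarrow> 'a) \<Rightarrow>\<^sub>0 'g::ab_group_add) set monoid)
               (ctl_homology n (CSing_MinCtl X))"
  unfolding singular_homology_def ctl_homology_def
  using simplicial_controlled_set_CSing_MinCtl[of X]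
  \<comment> \<open>\<open>f\<close> is constant in the degree because chains of all degrees share
    one type. What \<open>auto\<close> still has to check is that each degree is a controlled set
    and that the zero map \<open>singular_boundary 0\<close> stays in degree 0.\<close>
  by (intro allI chain_homology_iso[where f = "\<lambda>_. Poly_Mapping.lookup"] group_singular_chain_group
      group_ctl_sums lookup_iso_ctl_sums singular_boundary_closed lookup_singular_boundary)
    (auto simp: simplicial_controlled_set_def singular_boundary_def singular_chain_group_def)

end
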